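(* For all integers $n\ge0$ and $k\ge0$ and each $r\in\{1,2,3,4,5,6\}$, we have \[ \mathcal{EO}_u\left(2\times 7^{2k+2}n+2\times 7^{2k+1}r+\frac{7^{2k+2}-1}{6}\right)\equiv 0 \pmod{16}. \]
   Context: For a positive integer $k$, let $f_k:=(q^k;q^k)_\infty=\prod_{i=1}^\infty(1-q^{ki})$. The integers $\mathcal{EO}_u(n)$, $n\ge 0$, are defined by $\sum_{n=0}^\infty \mathcal{EO}_u(n)q^n=\dfrac{f_4^2}{f_2^2}$. *)

theory Defs
  imports "HOL-Analysis.Analysis" "HOL-Number_Theory.Cong"
begin

definition qprod :: "nat \<Rightarrow> int fps" where
  "qprod k = (\<Prod>i. 1 - fps_X ^ (k * Suc i))"

text \<open>
  The library has no division on \<^typ>\<open>int fps\<close>. Since \<open>qprod k\<close> has constant coefficient 1 for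
  positive \<open>k\<close>, the quotient is formed with the inverse power series whose constant coefficient
  is 1. Lemma \<open>EO_u_generating_function\<close> below states that this is the intended quotient.
\<close>

definition EO_u :: "nat \<Rightarrow> int" where
  "EO_u n = fps_nth ((qprod 4)\<^sup>2 * fps_right_inverse ((qprod 2)\<^sup>2) 1) n"

context
  fixes k :: nat
  assumes k: "k > 0"
begin

private definition P :: "nat \<Rightarrow> int fps" where
  "P n = (\<Prod>i\<le>n. 1 - fps_X ^ (k * Suc i))"

private lemma P_stable: "n \<ge> m \<Longrightarrow> fps_nth (P n) m = fps_nth (P m) m"
proof (induction n rule: dec_induct)
  case (step n)
  have less: "m < k * Suc (Suc n)"
  proof -
    have "m < 1 * Suc (Suc n)" using step.hyps(1) by simp
    also have "\<dots> \<le> k * Suc (Suc n)" using k by (intro mult_right_mono) auto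
    finally show ?thesis .
  qed
  have "P (Suc n) = P n - P n * fps_X ^ (k * Suc (Suc n))"
    unfolding P_def prod.atMost_Suc by (simp only: right_diff_distrib mult_1_right)
  then have "fps_nth (P (Suc n)) m = fps_nth (P n) m"
    using less by (simp only: fps_sub_nth fps_X_power_mult_right_nth if_True diff_zero)
  with step.IH show ?case by simp
qed simp

private lemma P_0: "fps_nth (P n) 0 = 1"
proof -
  have "fps_nth (P n) 0 = fps_nth (P 0) 0" by (rule P_stable) simp
  also have "P 0 = 1 - fps_X ^ k" by (simp add: P_def)
  also have "fps_nth (1 - fps_X ^ k :: int fps) 0 = 1" using k by simp
  finally show ?thesis .
qed

private lemma nz: "(1 - fps_X ^ (k * Suc i) :: int fps) \<noteq> 0"
proof
  assume "(1 - fps_X ^ (k * Suc i) :: int fps) = 0"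
  then have "fps_nth (1 - fps_X ^ (k * Suc i) :: int fps) 0 = 0" by (simp only: fps_zero_nth)
  with k show False by (simp add: fps_X_power_nth del: mult_Suc_right)
qed

lemma qprod_has_prod: "(\<lambda>i. 1 - fps_X ^ (k * Suc i)) has_prod qprod k"
proof -
  define L where "L = Abs_fps (\<lambda>m. fps_nth (P m) m)"
  have "P \<longlonglongrightarrow> L"
  proof (rule tendsto_fpsI)
    fix m
    show "\<forall>\<^sub>F n in sequentially. fps_nth (P n) m = fps_nth L m"
      using eventually_ge_at_top[of m] unfolding L_def fps_nth_Abs_fps
      by eventually_elim (rule P_stable)
  qed
  moreover have "fps_nth L 0 = 1"
    by (simp add: L_def P_0)
  then have "L \<noteq> 0" by auto
  ultimately have L: "(\<lambda>i. 1 - fps_X ^ (k * Suc i)) has_prod L"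
    unfolding has_prod_def raw_has_prod_def P_def[abs_def] add_0_right by blast
  have unique: "p = L" if "(\<lambda>i. 1 - fps_X ^ (k * Suc i)) has_prod p" for p :: "int fps"
  proof -
    have "P \<longlonglongrightarrow> p"
      using that nz unfolding has_prod_def raw_has_prod_def P_def[abs_def] add_0_right by blast
    with \<open>P \<longlonglongrightarrow> L\<close> show ?thesis
      using LIMSEQ_unique by blast
  qed
  have "qprod k = L"
    unfolding qprod_def prodinf_def using L unique by (rule the_equality)
  with L show ?thesis by simp
qed

lemma qprod_nth_0: "fps_nth (qprod k) 0 = 1"
proof -
  have "P \<longlonglongrightarrow> qprod k"
    using qprod_has_prod nz unfolding has_prod_def raw_has_prod_def P_def[abs_def] add_0_right by blast
  then have "\<forall>\<^sub>F n in sequentially. fps_nth (P n) 0 = fps_nth (qprod k) 0"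
    by (simp add: tendsto_fps_iff)
  then have "\<exists>n. fps_nth (P n) 0 = fps_nth (qprod k) 0"
    unfolding eventually_sequentially by blast
  then show ?thesis by (simp add: P_0)
qed

end

lemma EO_u_generating_function: "Abs_fps EO_u * (qprod 2)\<^sup>2 = (qprod 4)\<^sup>2"
proof -
  have "fps_nth ((qprod 2)\<^sup>2) 0 = 1"
    unfolding power2_eq_square fps_mult_nth_0 by (simp add: qprod_nth_0)
  then have inv: "(qprod 2)\<^sup>2 * fps_right_inverse ((qprod 2)\<^sup>2) 1 = 1"
    by (intro fps_right_inverse) simp
  have "Abs_fps EO_u * (qprod 2)\<^sup>2 = (qprod 4)\<^sup>2 * ((qprod 2)\<^sup>2 * fps_right_inverse ((qprod 2)\<^sup>2) 1)"
    unfolding EO_u_def[abs_def] fps_nth_inverse by (simp only: mult_ac)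
  then show ?thesis unfolding inv by simp
qed

end

theory Submission
  imports Defs
begin

text \<open>
  Write \<open>f\<^sub>k\<close> for \<open>qprod k\<close>, \<open>x = f\<^sub>2\<^sup>2\<close> and \<open>y = f\<^sub>4\<close>, so that the generating function is \<open>A = y\<^sup>2 / x\<close>.
  By Gauss' identity \<open>x / y\<close> is a theta series congruent to 1 modulo 2, hence
  \<open>x\<^sup>2 - y\<^sup>2\<close> is divisible by 4 and
  \<open>x y\<^sup>2 (A - 2 x + x\<^sup>3 / y\<^sup>2) = (x\<^sup>2 - y\<^sup>2)\<^sup>2\<close> is divisible by 16.
  Modulo 16 this gives \<open>A = 2 f\<^sub>2\<^sup>2 - f\<^sub>2 g\<close> where \<open>g = f\<^sub>2\<^sup>5 / f\<^sub>4\<^sup>2\<close> is, by Gordon's identity, a theta series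
  with the same exponents \<open>3 j\<^sup>2 - j\<close> as the pentagonal series \<open>f\<^sub>2\<close>. The coefficients of both products are thus
  supported on those \<open>m\<close> for which \<open>12 m + 2\<close> is a sum of two squares. For the \<open>m\<close> considered here,
  7 divides \<open>12 m + 2\<close> to an odd power, so that 7 being 3 modulo 4 rules this out.
\<close>

subsection \<open>The q-binomial theorem\<close>

text \<open>The Gaussian binomial coefficient, given by its Pascal rule instead of a quotient so
  that it makes sense in every commutative ring.\<close>

fun qbin :: "'a::comm_ring_1 \<Rightarrow> nat \<Rightarrow> nat \<Rightarrow> 'a" where
  "qbin Q n 0 = 1"
| "qbin Q 0 (Suc k) = 0"
| "qbin Q (Suc n) (Suc k) = qbin Q n k + Q ^ Suc k * qbin Q n (Suc k)"

lemma qbin_eq_0: "n < k \<Longrightarrow> qbin Q n k = 0"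
  by (induction Q n k rule: qbin.induct) auto

lemma qbin_self [simp]: "qbin Q n n = 1"
  by (induction n) (simp_all add: qbin_eq_0)

definition qpoch :: "'a::comm_ring_1 \<Rightarrow> nat \<Rightarrow> 'a" where
  "qpoch Q n = (\<Prod>i<n. 1 - Q ^ Suc i)"

lemma qpoch_0 [simp]: "qpoch Q 0 = 1"
  and qpoch_Suc: "qpoch Q (Suc n) = (1 - Q ^ Suc n) * qpoch Q n"
  by (simp_all add: qpoch_def mult.commute)

text \<open>The quotient formula with denominators cleared. Both terms of the Pascal rule reduce to
  \<open>qpoch Q (j + k - 1)\<close>, with weights \<open>1 - Q ^ k\<close> and
  \<open>Q ^ k * (1 - Q ^ j)\<close> that add up to \<open>1 - Q ^ (j + k)\<close>.\<close>

lemma qbin_qpoch: "qbin Q (j + k) k * (qpoch Q k * qpoch Q j) = qpoch Q (j + k)"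
proof (induction "j + k" arbitrary: j k)
  case (Suc n)
  show ?case
  proof (cases k)
    case (Suc k')
    have 1: "qbin Q (j + k') k' * (qpoch Q k' * qpoch Q j) = qpoch Q (j + k')"
      using Suc.hyps(1)[of j k'] Suc.hyps(2) Suc by simp
    show ?thesis
    proof (cases j)
      case 0
      then show ?thesis by simp
    next
      case (Suc j')
      have 2: "qbin Q (j' + k) k * (qpoch Q k * qpoch Q j') = qpoch Q (j' + k)"
        using Suc.hyps(1)[of j' k] Suc.hyps(2) Suc by simp
      have e: "j + k' = j' + k" "j + k = Suc (j + k')" using Suc \<open>k = Suc k'\<close> by auto
      have "qbin Q (j + k) k * (qpoch Q k * qpoch Q j) =
          (1 - Q ^ k) * (qbin Q (j + k') k' * (qpoch Q k' * qpoch Q j))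
          + Q ^ k * (1 - Q ^ j) * (qbin Q (j' + k) k * (qpoch Q k * qpoch Q j'))"
        unfolding e(2) using \<open>j = Suc j'\<close> \<open>k = Suc k'\<close>
        by (simp add: qpoch_Suc del: power_Suc) (simp add: algebra_simps del: power_Suc)
      also have "\<dots> = (1 - Q ^ k) * qpoch Q (j + k') + Q ^ k * (1 - Q ^ j) * qpoch Q (j' + k)"
        by (simp only: 1 2)
      also have "\<dots> = ((1 - Q ^ k) + Q ^ k * (1 - Q ^ j)) * qpoch Q (j + k')"
        unfolding e(1) by (simp add: algebra_simps)
      also have "(1 - Q ^ k) + Q ^ k * (1 - Q ^ j) = 1 - Q ^ Suc (j + k')"
        unfolding e(2)[symmetric] by (simp add: algebra_simps power_add)
      finally show ?thesis unfolding e(2) by (simp only: qpoch_Suc)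
    qed
  qed simp
qed simp

text \<open>Removing the factor \<open>i = 0\<close> leaves the same product with
  \<open>b * Q\<close> in place of \<open>b\<close>, which drives the induction. The form
  homogeneous in \<open>a\<close> and \<open>b\<close> lets \<open>a\<close> be a power of
  \<open>Q\<close> later, which avoids negative exponents.\<close>

lemma q_binomial:
  "(\<Prod>i<N. a + b * Q ^ i) =
     (\<Sum>k\<le>N. qbin Q N k * Q ^ (k * (k - 1) div 2) * b ^ k * a ^ (N - k))"
proof (induction N arbitrary: b)
  case (Suc N)
  let ?t = "\<lambda>k. k * (k - 1) div 2 :: nat"
  have tri: "?t (Suc k) = ?t k + k" for k
    by (cases k) (auto simp: algebra_simps)
  define S where "S = (\<Sum>k\<le>N. qbin Q N k * Q ^ (?t k) * (b * Q) ^ k * a ^ (N - k))"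
  have a: "a * S = a ^ Suc N + (\<Sum>k\<le>N. Q ^ Suc k * qbin Q N (Suc k) * Q ^ (?t (Suc k))
      * b ^ Suc k * a ^ (N - k))"
  proof -
    have "a * S = (\<Sum>k\<le>Suc N. Q ^ k * qbin Q N k * Q ^ (?t k) * b ^ k * a ^ (Suc N - k))"
      unfolding S_def sum_distrib_left
      by (simp add: qbin_eq_0) (intro sum.cong, auto simp: Suc_diff_le power_mult_distrib mult_ac)
    also have "\<dots> = a ^ Suc N + (\<Sum>k\<le>N. Q ^ Suc k * qbin Q N (Suc k) * Q ^ (?t (Suc k))
        * b ^ Suc k * a ^ (N - k))"
      by (subst sum.atMost_Suc_shift) (simp del: power_Suc)
    finally show ?thesis .
  qed
  have b: "b * S = (\<Sum>k\<le>N. qbin Q N k * Q ^ (?t (Suc k)) * b ^ Suc k * a ^ (N - k))"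
    unfolding S_def sum_distrib_left tri
    by (intro sum.cong) (auto simp: power_mult_distrib power_add mult_ac)
  have "(\<Prod>i<Suc N. a + b * Q ^ i) = (a + b) * (\<Prod>i<N. a + (b * Q) * Q ^ i)"
    by (subst prod.lessThan_Suc_shift) (simp add: mult_ac)
  also have "\<dots> = a * S + b * S"
    unfolding Suc.IH S_def by (simp add: distrib_right)
  also have "\<dots> = a ^ Suc N + (\<Sum>k\<le>N. qbin Q (Suc N) (Suc k) * Q ^ (?t (Suc k)) * b ^ Suc k
      * a ^ (N - k))"
    unfolding a b by (simp add: sum.distrib algebra_simps del: power_Suc)
  also have "\<dots> = (\<Sum>k\<le>Suc N. qbin Q (Suc N) k * Q ^ (?t k) * b ^ k * a ^ (Suc N - k))"
    by (subst sum.atMost_Suc_shift) (simp del: power_Suc)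
  finally show ?case .
qed simp

lemma pderiv_sum: "pderiv (sum f A) = (\<Sum>i\<in>A. pderiv (f i))"
  by (induction A rule: infinite_finite_induct) (simp_all add: pderiv_add)

lemma const_poly_power: "[:c:] ^ n = [:c ^ n:]"
  by (induction n) (simp_all add: mult.commute)

lemma qbin_const_poly: "qbin [:Q:] n k = [:qbin Q n k:]"
  by (induction Q n k rule: qbin.induct) (simp_all add: const_poly_power mult_ac one_pCons)

text \<open>The q-binomial theorem is differentiated in \<open>b\<close>, read as a polynomial
  variable, at a zero of the factor \<open>j\<close>. In the product rule only the term that
  differentiates this factor survives.\<close>

lemma q_binomial_deriv:
  fixes a b Q :: "'a::idom"
  assumes "j < N" "a + b * Q ^ j = 0"
  shows "Q ^ j * (\<Prod>i\<in>{..<N} - {j}. a + b * Q ^ i) =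
     (\<Sum>k\<le>N. of_nat k * (qbin Q N k * Q ^ (k * (k - 1) div 2) * b ^ (k - 1) * a ^ (N - k)))"
proof -
  have "[:a:] + [:0, 1:] * [:Q:] ^ i = [:a, Q ^ i:]" for i
    by (simp add: const_poly_power)
  moreover have "qbin [:Q:] N k * [:Q:] ^ m * [:0, 1:] ^ k * [:a:] ^ l
      = monom (qbin Q N k * Q ^ m * a ^ l) k" for k l m
    by (simp add: qbin_const_poly const_poly_power monom_altdef mult_ac)
  ultimately have "(\<Prod>i<N. [:a, Q ^ i:]) =
      (\<Sum>k\<le>N. monom (qbin Q N k * Q ^ (k * (k - 1) div 2) * a ^ (N - k)) k)"
    using q_binomial[of "[:a:]" "[:0, 1:]" "[:Q:]" N] by simp
  then have "poly (pderiv (\<Prod>i<N. [:a, Q ^ i:])) b =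
      poly (pderiv (\<Sum>k\<le>N. monom (qbin Q N k * Q ^ (k * (k - 1) div 2) * a ^ (N - k)) k)) b"
    by simp
  also have "poly (pderiv (\<Prod>i<N. [:a, Q ^ i:])) b
      = (\<Sum>i<N. (\<Prod>l\<in>{..<N}-{i}. a + b * Q ^ l) * Q ^ i)"
    by (simp add: pderiv_prod poly_sum poly_prod pderiv_pCons mult.commute)
  also have "\<dots> = (\<Sum>i\<in>{j}. (\<Prod>l\<in>{..<N}-{i}. a + b * Q ^ l) * Q ^ i)"
    using assms by (intro sum.mono_neutral_right) (auto simp: prod_zero_iff)
  also have "poly (pderiv (\<Sum>k\<le>N. monom (qbin Q N k * Q ^ (k * (k - 1) div 2) * a ^ (N - k)) k)) b
    = (\<Sum>k\<le>N. of_nat k * (qbin Q N k * Q ^ (k * (k - 1) div 2) * b ^ (k - 1) * a ^ (N - k)))"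
    by (simp add: pderiv_sum pderiv_monom poly_sum poly_monom mult_ac)
  finally show ?thesis by (simp add: mult.commute)
qed

subsection \<open>Congruences of power series\<close>

lemma fps_X_power_dvd_iff: "fps_X ^ n dvd f \<longleftrightarrow> (\<forall>i<n. fps_nth f i = 0)"
  for f :: "'a::comm_ring_1 fps"
proof
  assume "\<forall>i<n. fps_nth f i = 0"
  then have "f = fps_X ^ n * fps_shift n f"
    by (intro fps_ext) (auto simp: fps_X_power_mult_nth)
  then show "fps_X ^ n dvd f" by (rule dvdI)
qed (auto simp: fps_X_power_mult_nth elim!: dvdE)

text \<open>Replaces passing to the limit: identities of infinite products are checked on finite
  truncations modulo every power of \<open>fps_X\<close>.\<close>

lemma fps_eqI_dvd: "(\<And>n. fps_X ^ n dvd f - g) \<Longrightarrow> f = g"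
  for f g :: "'a::comm_ring_1 fps"
  by (rule fps_ext) (metis fps_X_power_dvd_iff fps_sub_nth lessI right_minus_eq)

lemma fps_unit_dvd_cancel:
  fixes f g :: "'a::comm_ring_1 fps"
  assumes "fps_nth f 0 = 1" "h dvd f * g"
  shows "h dvd g"
proof -
  have "f * fps_right_inverse f 1 = 1"
    using assms(1) by (intro fps_right_inverse) simp
  then have "g = fps_right_inverse f 1 * (f * g)"
    by (metis mult.assoc mult.commute mult_1)
  with assms(2) show ?thesis by (metis dvd_mult)
qed

lemma dvd_diff_mult:
  fixes a b c d e :: "'a::comm_ring_1"
  assumes "e dvd a - b" "e dvd c - d"
  shows "e dvd a * c - b * d"
proof -
  have "a * c - b * d = (a - b) * c + b * (c - d)" by (simp add: algebra_simps)
  with assms show ?thesis by (simp add: dvd_add)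
qed

lemma qpoch_cong:
  assumes "d > 0" "n \<le> m"
  shows "fps_X ^ Suc n dvd qpoch (fps_X ^ d :: int fps) m - qpoch (fps_X ^ d) n"
  using assms(2)
proof (induction m rule: dec_induct)
  case (step m)
  have "Suc n \<le> d * Suc m" using \<open>d > 0\<close> step.hyps
      by (metis Suc_le_mono le_trans mult_le_mono1 nat_mult_1 Suc_leI One_nat_def)
  then have "fps_X ^ Suc n dvd (fps_X ^ d :: int fps) ^ Suc m"
    unfolding power_mult[symmetric] by (rule le_imp_power_dvd)
  moreover have "qpoch (fps_X ^ d :: int fps) (Suc m) - qpoch (fps_X ^ d) n =
      (qpoch (fps_X ^ d) m - qpoch (fps_X ^ d) n) - (fps_X ^ d) ^ Suc m * qpoch (fps_X ^ d) m"
    unfolding qpoch_Suc by (simp add: algebra_simps del: power_Suc)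
  ultimately show ?case using step.IH by (simp only: dvd_diff dvd_mult2)
qed simp

lemma qprod_cong:
  assumes d: "d > 0"
  shows "fps_X ^ Suc n dvd qprod d - qpoch (fps_X ^ d) n"
proof -
  have nz: "(1 - fps_X ^ (d * Suc i) :: int fps) \<noteq> 0" for i
  proof
    assume "(1 - fps_X ^ (d * Suc i) :: int fps) = 0"
    then have "fps_nth (1 - fps_X ^ (d * Suc i) :: int fps) 0 = 0" by (simp only: fps_zero_nth)
    with d show False by (simp add: fps_X_power_nth del: mult_Suc_right)
  qed
  have "(\<lambda>n. \<Prod>i\<le>n. 1 - fps_X ^ (d * Suc i)) \<longlonglongrightarrow> qprod d"
    using qprod_has_prod[OF d] nz unfolding has_prod_def raw_has_prod_def add_0_right by blast
  then have lim: "(\<lambda>n. qpoch (fps_X ^ d) (Suc n)) \<longlonglongrightarrow> qprod d"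
    unfolding qpoch_def power_mult[symmetric] lessThan_Suc_atMost .
  show ?thesis unfolding fps_X_power_dvd_iff
  proof (intro allI impI)
    fix i assume i: "i < Suc n"
    have "\<forall>\<^sub>F m in sequentially. fps_nth (qpoch (fps_X ^ d) (Suc m)) i = fps_nth (qprod d) i"
      using lim unfolding tendsto_fps_iff by blast
    with eventually_ge_at_top[of n] 
    have "\<forall>\<^sub>F m in sequentially. m \<ge> n \<and> fps_nth (qpoch (fps_X ^ d) (Suc m)) i
        = fps_nth (qprod d) i"
      by eventually_elim simp
    then obtain m where m: "m \<ge> n" "fps_nth (qpoch (fps_X ^ d) (Suc m)) i = fps_nth (qprod d) i"
      by (auto simp: eventually_sequentially)
    have "n \<le> Suc m" using m by simp
    from qpoch_cong[OF d this] i m(2) show "fps_nth (qprod d - qpoch (fps_X ^ d) n) i = 0"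
      unfolding fps_X_power_dvd_iff by simp
  qed
qed

text \<open>As \<open>j\<close> and \<open>k\<close> grow, the Gaussian binomial tends to the
  inverse of \<open>qprod d\<close>: up to exponent \<open>l\<close> all three finite products in
  \<open>qbin_qpoch\<close> may be replaced by \<open>qprod d\<close>, and one factor
  cancels.\<close>

lemma qbin_cong:
  assumes d: "d > 0" and "l \<le> j" "l \<le> k"
  shows "fps_X ^ Suc l dvd qbin (fps_X ^ d) (j + k) k * qprod d - 1"
proof -
  let ?q = "qpoch (fps_X ^ d :: int fps)" and ?X = "fps_X ^ Suc l :: int fps"
  have *: "?X dvd qprod d - ?q m" if "l \<le> m" for m
    using qprod_cong[OF d, of m] that by (meson dvd_trans le_imp_power_dvd Suc_le_mono)
  have "?X dvd qprod d * qprod d - ?q k * ?q j"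
    by (intro dvd_diff_mult * assms)
  then have "?X dvd qbin (fps_X ^ d) (j + k) k * (qprod d * qprod d - ?q k * ?q j)
      - (qprod d - ?q (j + k))"
    using *[of "j + k"] assms by (simp only: dvd_diff dvd_mult trans_le_add1)
  also have "\<dots> = qprod d * (qbin (fps_X ^ d) (j + k) k * qprod d - 1)"
    using qbin_qpoch[of "fps_X ^ d :: int fps" j k] by (simp add: algebra_simps)
  finally show ?thesis using fps_unit_dvd_cancel qprod_nth_0[OF d] by blast
qed

subsection \<open>Theta series\<close>

text \<open>The series of all terms \<open>c i * X ^ e i\<close>. It has this meaning when the
  fibres of \<open>e\<close> are finite, since a sum over an infinite set is 0 by
  convention.\<close>

definition gseries :: "('i \<Rightarrow> int) \<Rightarrow> ('i \<Rightarrow> nat) \<Rightarrow> int fps" where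
  "gseries c e = Abs_fps (\<lambda>m. \<Sum>i | e i = m. c i)"

lemma gseries_nth: "fps_nth (gseries c e) m = (\<Sum>i | e i = m. c i)"
  by (simp add: gseries_def)

lemma gseries_mult:
  assumes "\<And>m. finite {i. e i = m}" "\<And>m. finite {i. e' i = m}"
  shows "gseries c e * gseries c' e' = gseries (\<lambda>(i, j). c i * c' j) (\<lambda>(i, j). e i + e' j)"
proof (rule fps_ext)
  fix m
  have "fps_nth (gseries c e * gseries c' e') m =
      (\<Sum>l=0..m. \<Sum>(i, j)\<in>{i. e i = l} \<times> {j. e' j = m - l}. c i * c' j)"
    by (simp add: fps_mult_nth gseries_nth sum_product sum.cartesian_product)
  also have "\<dots> = (\<Sum>(i, j)\<in>(\<Union>l\<in>{0..m}. {i. e i = l} \<times> {j. e' j = m - l}). c i * c' j)"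
    using assms by (subst sum.UNION_disjoint) auto
  also have "(\<Union>l\<in>{0..m}. {i. e i = l} \<times> {j. e' j = m - l}) = {x. (\<lambda>(i, j). e i + e' j) x = m}"
    by auto
  finally show "fps_nth (gseries c e * gseries c' e') m =
      fps_nth (gseries (\<lambda>(i, j). c i * c' j) (\<lambda>(i, j). e i + e' j)) m"
    by (simp add: gseries_nth)
qed

text \<open>The exponent of \<open>X\<close> in \<open>x\<^sup>j Q\<^bsup>j (j - 1) / 2\<^esup>\<close> for \<open>x = X\<^sup>a\<close> and \<open>Q = X\<^sup>D\<close>; it is nonnegative if \<open>a \<le> D\<close>.\<close>

definition theta_exp :: "nat \<Rightarrow> nat \<Rightarrow> int \<Rightarrow> nat" where
  "theta_exp D a j = nat (int D * (j * (j - 1) div 2) + int a * j)"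

lemma two_triangle: "2 * (j * (j - 1) div 2) = j * (j - 1)" for j :: int
  by simp

text \<open>Linear growth of the exponents ensures that \<open>nat\<close> in
  \<open>theta_exp\<close> truncates nothing, that each exponent is attained finitely often, and
  that terms with large \<open>j\<close> are negligible modulo a power of
  \<open>fps_X\<close>.\<close>

lemma theta_exp_bound:
  assumes "D > 0" "a \<le> D"
  shows "int D * (j * (j - 1) div 2) + int a * j \<ge> \<bar>j\<bar> - 1"
proof -
  define t where "t = j * (j - 1) div 2"
  have t: "2 * t = j * (j - 1)" unfolding t_def by simp
  show ?thesis
  proof (cases "j \<ge> 0")
    case True
    have "0 \<le> (j - 1) * (j - 2)"
      by (cases "j \<ge> 2"; cases "j = 1"; cases "j = 0") (use True in auto)
    then have "j - 1 \<le> t" using t by (simp add: algebra_simps)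
    moreover have "t \<ge> 0"
      using \<open>j - 1 \<le> t\<close> t by (cases "j = 0") (use True in auto)
    then have "t \<le> int D * t" using assms(1) by (simp add: mult_le_cancel_right1)
    moreover have "int a * j \<ge> 0" using True by simp
    ultimately show ?thesis using True unfolding t_def[symmetric] by linarith
  next
    case False
    \<comment> \<open>This product equals \<open>2 * (t + 2 * j + 1)\<close>. For negative
      \<open>j\<close> the bound \<open>a \<le> D\<close> then allows estimating
      \<open>a * j\<close> by \<open>D * j\<close>.\<close>
    have "0 \<le> (j + 1) * (j + 2)"
      by (cases "j = -1"; cases "j \<le> -2") (use False in \<open>auto simp: mult_nonpos_nonpos\<close>)
    then have "-j - 1 \<le> t + j" using t by (simp add: algebra_simps)
    moreover have "t + j \<le> int D * (t + j)"
      using False assms(1) calculation by (simp add: mult_le_cancel_right1)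
    moreover have "int a * j \<ge> int D * j" using False assms(2) by simp
    ultimately show ?thesis using False distrib_left[of "int D" t j]
        unfolding t_def[symmetric] by linarith
  qed
qed

lemma int_theta_exp:
  assumes "D > 0" "a \<le> D"
  shows "int (theta_exp D a j) = int D * (j * (j - 1) div 2) + int a * j"
proof -
  have "int D * (j * (j - 1) div 2) + int a * j \<ge> 0"
    using theta_exp_bound[OF assms, of j] by (cases "j = 0") auto
  then show ?thesis by (simp add: theta_exp_def)
qed

lemma theta_exp_ge:
  assumes "D > 0" "a \<le> D"
  shows "\<bar>j\<bar> \<le> int (theta_exp D a j) + 1"
  using theta_exp_bound[OF assms, of j] int_theta_exp[OF assms, of j] by simp

lemma finite_theta_exp:
  assumes "D > 0" "a \<le> D"
  shows "finite {j. theta_exp D a j = m}"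
proof (rule finite_subset)
  have "j \<in> {- int m - 1..int m + 1}" if "theta_exp D a j = m" for j
    using theta_exp_ge[OF assms, of j] that by auto
  then show "{j. theta_exp D a j = m} \<subseteq> {- int m - 1..int m + 1}" by blast
qed simp

text \<open>In term \<open>j\<close> the binomial is correct modulo
  \<open>fps_X ^ (n - |j| + 1)\<close> and the exponent is at least \<open>|j| - 1\<close>, which
  together reach \<open>n\<close>. The offset \<open>\<delta>\<close> is 0 for the triple product
  and 1 for Jacobi's cube.\<close>

lemma theta_limit:
  fixes c :: "int \<Rightarrow> int"
  assumes D: "D > 0" "a \<le> D"
  shows "fps_X ^ n dvd
    (\<Sum>j=-int n..int (n + \<delta>). fps_const (c j) * qbin (fps_X ^ D) (2 * n + \<delta>) (nat (int n + j))
        * fps_X ^ theta_exp D a j)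
      * qprod D - gseries c (theta_exp D a)"
proof -
  let ?J = "{-int n..int (n + \<delta>)}" and ?E = "theta_exp D a"
  let ?B = "\<lambda>j. qbin (fps_X ^ D) (2 * n + \<delta>) (nat (int n + j))"
  have "fps_X ^ n dvd fps_const (c j) * (fps_X ^ ?E j * (?B j * qprod D - 1))" if j: "j \<in> ?J"
      for j
  proof -
    define l where "l = nat (int n - \<bar>j\<bar>)"
    show ?thesis
    proof (cases "\<bar>j\<bar> \<le> int n")
      case True
      have "fps_X ^ Suc l dvd ?B j * qprod D - 1"
      proof -
        have "nat (int (n + \<delta>) - j) + nat (int n + j) = 2 * n + \<delta>"
          "l \<le> nat (int (n + \<delta>) - j)" "l \<le> nat (int n + j)"
          using j True by (auto simp: l_def)
        then show ?thesis using qbin_cong[OF D(1)] by metis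
      qed
      then have "fps_X ^ (?E j + Suc l) dvd fps_X ^ ?E j * (?B j * qprod D - 1)"
        unfolding power_add by (rule mult_dvd_mono[OF dvd_refl])
      moreover have "n \<le> ?E j + Suc l" using theta_exp_ge[OF D, of j] True by (simp add: l_def)
      ultimately show ?thesis by (meson dvd_mult dvd_trans le_imp_power_dvd)
    next
      case False
      \<comment> \<open>Here the binomial gives no precision, but the monomial alone
        suffices.\<close>
      then have "n \<le> ?E j" using theta_exp_ge[OF D, of j] by linarith
      then show ?thesis by (simp add: le_imp_power_dvd)
    qed
  qed
  then have 1: "fps_X ^ n dvd (\<Sum>j\<in>?J. fps_const (c j) * (fps_X ^ ?E j * (?B j * qprod D - 1)))"
    by (rule dvd_sum)
  have 2: "fps_X ^ n dvd (\<Sum>j\<in>?J. fps_const (c j) * fps_X ^ ?E j) - gseries c ?E"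
    unfolding fps_X_power_dvd_iff
  proof (intro allI impI)
    fix i assume i: "i < n"
    have "fps_nth (\<Sum>j\<in>?J. fps_const (c j) * fps_X ^ ?E j) i
        = (\<Sum>j\<in>?J. if ?E j = i then c j else 0)"
      by (simp add: fps_sum_nth fps_X_power_nth) (intro sum.cong, auto)
    also have "\<dots> = (\<Sum>j\<in>{j\<in>?J. ?E j = i}. c j)"
      by (rule sum.inter_filter[symmetric]) simp
    also have "{j\<in>?J. ?E j = i} = {j. ?E j = i}"
    proof -
      have "j \<in> ?J" if "?E j = i" for j 
        using theta_exp_ge[OF D, of j] that i unfolding atLeastAtMost_iff of_nat_add by linarith
      then show ?thesis by blast
    qed
    finally show "fps_nth ((\<Sum>j\<in>?J. fps_const (c j) * fps_X ^ ?E j) - gseries c ?E) i = 0"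
      by (simp add: gseries_nth)
  qed
  have regroup: "x * b * y * q = x * (y * (b * q - 1)) + x * y" for b q x y :: "int fps"
    by (simp add: algebra_simps)
  have "(\<Sum>j\<in>?J. fps_const (c j) * ?B j * fps_X ^ ?E j) * qprod D =
     (\<Sum>j\<in>?J. fps_const (c j) * (fps_X ^ ?E j * (?B j * qprod D - 1)))
     + (\<Sum>j\<in>?J. fps_const (c j) * fps_X ^ ?E j)"
    unfolding sum_distrib_right sum.distrib[symmetric]
    by (intro sum.cong refl regroup)
  then show ?thesis
    using dvd_add[OF 1 2] by (simp only: add_diff_eq)
qed

subsection \<open>The Jacobi triple product\<close>

definition alt :: "int \<Rightarrow> int" where
  "alt j = (if even j then 1 else -1)"

lemma alt_diff: "alt (i - j) = alt i * alt j"
  by (auto simp: alt_def)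

lemma fps_const_int: "fps_const c = (of_int c :: int fps)"
  using fps_of_int[of c, where 'a = int] by simp

lemma alt_of_nat: "(of_int (alt (int n)) :: 'a::comm_ring_1) = (- 1) ^ n"
  by (simp add: alt_def)

lemma sum_atMost_int_shift:
  "(\<Sum>k\<le>2 * n + \<delta>. g k) = (\<Sum>j=-int n..int (n + \<delta>). g (nat (int n + j)))"
  by (rule sum.reindex_bij_witness[where i = "\<lambda>j. nat (int n + j)" and j = "\<lambda>k. int k - int n"])
     auto

text \<open>Exponents in the q-binomial theorem with \<open>X ^ (D * n)\<close>,
  \<open>- (X ^ a)\<close> and \<open>X ^ D\<close> for \<open>a\<close>, \<open>b\<close> and
  \<open>Q\<close>: centring the index as \<open>k = n + j\<close> leaves a constant plus the theta
  exponent of \<open>j\<close>.\<close>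

lemma theta_exp_shift:
  assumes "D > 0" "a \<le> D" "k \<le> 2 * n + \<delta>"
  shows "D * (k * (k - 1) div 2) + a * k + D * n * (2 * n + \<delta> - k) =
    D * (n * n + n * \<delta> + n * (n - 1) div 2) + a * n + theta_exp D a (int k - int n)"
proof -
  have tri: "2 * int (m * (m - 1) div 2) = int m * (int m - 1)" for m :: nat
  proof -
    have "2 * (m * (m - 1) div 2) = m * (m - 1)"
      by (rule dvd_mult_div_cancel) (cases m, auto)
    then have "2 * int (m * (m - 1) div 2) = int (m * (m - 1))"
      by (metis of_nat_mult of_nat_numeral)
    then show ?thesis by (cases m) (simp_all add: algebra_simps)
  qed
  define T where "T = (int k - int n) * (int k - int n - 1) div 2"
  have T: "2 * T = (int k - int n) * (int k - int n - 1)" unfolding T_def by (rule two_triangle)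
  have r: "int (2 * n + \<delta> - k) = 2 * int n + int \<delta> - int k" using assms(3) by simp
  define K M where "K = int (k * (k - 1) div 2)" and "M = int (n * (n - 1) div 2)"
  have "2 * (K + int n * (2 * int n + int \<delta> - int k))
      = 2 * (int n * int n + int n * int \<delta> + M + T)"
    using T tri[of k] tri[of n] unfolding K_def[symmetric] M_def[symmetric]
        by (simp add: algebra_simps)
  then have *: "K + int n * (2 * int n + int \<delta> - int k) = int n * int n + int n * int \<delta> + M + T"
      by simp
  have "int (D * (k * (k - 1) div 2) + a * k + D * n * (2 * n + \<delta> - k)) =
     int D * (K + int n * (2 * int n + int \<delta> - int k)) + int a * int k"
    unfolding of_nat_add of_nat_mult r K_def by (simp add: algebra_simps)
  also have "\<dots> = int (D * (n * n + n * \<delta> + n * (n - 1) div 2) + a * n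
      + theta_exp D a (int k - int n))"
    unfolding * of_nat_add of_nat_mult int_theta_exp[OF assms(1,2)] M_def T_def
        by (simp add: algebra_simps)
  finally show ?thesis by (simp only: of_nat_eq_iff)
qed

lemma q_binomial_term:
  fixes X :: "'a::comm_ring_1"
  assumes "D > 0" "a \<le> D" "k \<le> 2 * n + \<delta>"
  shows "qbin (X ^ D) (2 * n + \<delta>) k * (X ^ D) ^ (k * (k - 1) div 2) * (- (X ^ a)) ^ k
      * ((X ^ D) ^ n) ^ (2 * n + \<delta> - k) =
    X ^ (D * (n * n + n * \<delta> + n * (n - 1) div 2) + a * n) *
    ((- 1) ^ k * qbin (X ^ D) (2 * n + \<delta>) k * X ^ theta_exp D a (int k - int n))"
proof -
  have "(X ^ D) ^ (k * (k - 1) div 2) * (- (X ^ a)) ^ k * ((X ^ D) ^ n) ^ (2 * n + \<delta> - k)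
      = (- 1) ^ k * X ^ (D * (k * (k - 1) div 2) + a * k + D * n * (2 * n + \<delta> - k))"
    by (subst power_minus) (simp add: power_add power_mult)
  then have "qbin (X ^ D) (2 * n + \<delta>) k
      * ((X ^ D) ^ (k * (k - 1) div 2) * (- (X ^ a)) ^ k * ((X ^ D) ^ n) ^ (2 * n + \<delta> - k)) =
      qbin (X ^ D) (2 * n + \<delta>) k * ((- 1) ^ k
          * X ^ (D * (n * n + n * \<delta> + n * (n - 1) div 2) + a * n
          + theta_exp D a (int k - int n)))"
    unfolding theta_exp_shift[OF assms] by simp
  then show ?thesis unfolding power_add[of X "D * (n * n + n * \<delta> + n * (n - 1) div 2) + a
      * n" "theta_exp D a (int k - int n)"]
    by (simp only: mult_ac)
qed

lemma prod_power_linear: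
  "(\<Prod>i<n. - (X ^ (a + D * i))) = (- 1) ^ n * X ^ (a * n + D * (n * (n - 1) div 2))"
  for X :: "'a::comm_ring_1"
proof (induction n)
  case (Suc n)
  have "Suc n * (Suc n - 1) div 2 = n * (n - 1) div 2 + n"
    by (cases n) (auto simp: algebra_simps)
  then show ?case using Suc by (simp add: power_add algebra_simps)
qed simp

text \<open>The q-binomial theorem with the \<open>2 * n\<close> factors
  \<open>X ^ (D * n) - X ^ (a + D * i)\<close>. When the lower power is taken out of each, the first
  \<open>n\<close> factors give the family with \<open>D - a\<close> in reverse order and the last
  \<open>n\<close> the family with \<open>a\<close>. The monomial that both sides share is
  cancelled.\<close>

lemma jacobi_triple_finite:
  assumes D: "D > 0" "a \<le> D"
  shows "(\<Prod>i<n. (1 - fps_X ^ (a + D * i)) * (1 - fps_X ^ (D - a + D * i))) =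
    (\<Sum>j=-int n..int n. fps_const (alt j) * qbin (fps_X ^ D) (2 * n) (nat (int n + j))
       * fps_X ^ theta_exp D a j)"
    (is "?P = ?S")
proof -
  define X :: "int fps" where "X = fps_X"
  define C where "C = D * (n * n + n * (n - 1) div 2) + a * n"
  have "(\<Prod>i<2 * n. (X ^ D) ^ n + - (X ^ a) * (X ^ D) ^ i) =
      (\<Sum>k\<le>2 * n + 0. qbin (X ^ D) (2 * n + 0) k * (X ^ D) ^ (k * (k - 1) div 2) * (- (X ^ a)) ^ k
      * ((X ^ D) ^ n) ^ (2 * n + 0 - k))"
    unfolding q_binomial by simp
  also have "\<dots> = (\<Sum>k\<le>2 * n + 0. X ^ C * (- 1) ^ n
      * (fps_const (alt (int k - int n)) * qbin (X ^ D) (2 * n) k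
      * X ^ theta_exp D a (int k - int n)))"
  proof (rule sum.cong)
    fix k assume "k \<in> {..2 * n + 0}"
    then have "k \<le> 2 * n + 0" by simp
    from q_binomial_term[OF D this, of X]
    show "qbin (X ^ D) (2 * n + 0) k * (X ^ D) ^ (k * (k - 1) div 2) * (- (X ^ a)) ^ k
      * ((X ^ D) ^ n) ^ (2 * n + 0 - k) = X ^ C * (- 1) ^ n
          * (fps_const (alt (int k - int n)) * qbin (X ^ D) (2 * n) k
          * X ^ theta_exp D a (int k - int n))"
      by (simp add: C_def alt_diff fps_const_int alt_of_nat mult_ac flip: power_mult_distrib)
  qed simp
  also have "\<dots> = X ^ C * (- 1) ^ n * ?S"
    unfolding sum_atMost_int_shift sum_distrib_left X_def by (intro sum.cong) auto
  finally have 1: "(\<Prod>i<2 * n. (X ^ D) ^ n + - (X ^ a) * (X ^ D) ^ i) = X ^ C * (- 1) ^ n * ?S" .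
  have "(\<Prod>i<2 * n. (X ^ D) ^ n + - (X ^ a) * (X ^ D) ^ i) =
    (\<Prod>i<n. (X ^ D) ^ n + - (X ^ a) * (X ^ D) ^ i)
        * (\<Prod>i<n. (X ^ D) ^ n + - (X ^ a) * (X ^ D) ^ (i + n))"
    using prod.atLeastLessThan_concat[of 0 n "2 * n" "\<lambda>i. (X ^ D) ^ n + - (X ^ a) * (X ^ D) ^ i"]
      prod.shift_bounds_nat_ivl[of "\<lambda>i. (X ^ D) ^ n + - (X ^ a) * (X ^ D) ^ i" 0 n n]
    by (simp add: lessThan_atLeast0 mult_2)
  also have "(\<Prod>i<n. (X ^ D) ^ n + - (X ^ a) * (X ^ D) ^ i) =
    (\<Prod>i<n. - (X ^ (a + D * i)) * (1 - X ^ (D - a + D * (n - Suc i))))"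
  proof (rule prod.cong)
    fix i assume "i \<in> {..<n}"
    then obtain m where n: "n = Suc i + m" by (metis lessThan_iff less_iff_Suc_add add_Suc)
    have "a + D * i + (D - a + D * m) = D * n" using D(2) n by (simp add: algebra_simps)
    then have "X ^ (a + D * i) * X ^ (D - a + D * m) = (X ^ D) ^ n"
      by (simp only: power_add[symmetric] power_mult[symmetric])
    then show "(X ^ D) ^ n + - (X ^ a) * (X ^ D) ^ i
        = - (X ^ (a + D * i)) * (1 - X ^ (D - a + D * (n - Suc i)))"
      using n by (simp add: algebra_simps) (simp add: power_add power_mult)
  qed simp
  also have "\<dots> = (- 1) ^ n * X ^ (a * n + D * (n * (n - 1) div 2))
      * (\<Prod>i<n. 1 - X ^ (D - a + D * i))"
    using prod.nat_diff_reindex[of "\<lambda>i. 1 - X ^ (D - a + D * i)" n]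
    by (simp only: prod.distrib prod_power_linear)
  also have "(\<Prod>i<n. (X ^ D) ^ n + - (X ^ a) * (X ^ D) ^ (i + n))
      = (X ^ D) ^ (n * n) * (\<Prod>i<n. 1 - X ^ (a + D * i))"
  proof -
    have "(X ^ D) ^ n + - (X ^ a) * (X ^ D) ^ (i + n) = (X ^ D) ^ n * (1 - X ^ (a + D * i))" for i
      by (simp add: power_add power_mult algebra_simps)
    then show ?thesis by (simp add: prod.distrib power_mult)
  qed
  finally have "(\<Prod>i<2 * n. (X ^ D) ^ n + - (X ^ a) * (X ^ D) ^ i) = X ^ C * (- 1) ^ n * ?P"
    by (simp only: X_def C_def prod.distrib power_add mult_ac distrib_left power_mult)
  with 1 have "X ^ C * (- 1) ^ n * ?P = X ^ C * (- 1) ^ n * ?S" by (simp only:)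
  moreover have "X ^ C * (- 1) ^ n \<noteq> 0" by (simp add: X_def)
  ultimately show ?thesis by (rule mult_left_cancel[THEN iffD1, rotated])
qed

text \<open>At \<open>a = 0\<close> the triple product degenerates, since one factor vanishes. With
  \<open>2 * n + 1\<close> factors, differentiating in \<open>b\<close> at \<open>b = -1\<close>
  removes just the vanishing factor \<open>i = n\<close> and brings in the weight \<open>j\<close>;
  the other factors give the square.\<close>

lemma qpoch_square_finite:
  assumes D: "D > 0"
  shows "- (qpoch (fps_X ^ D) n)\<^sup>2 =
    (\<Sum>j=-int n..int (n + 1). fps_const (alt j * j)
        * qbin (fps_X ^ D) (2 * n + 1) (nat (int n + j))
       * fps_X ^ theta_exp D 0 j)"
    (is "_ = ?S")
proof -
  define X :: "int fps" where "X = fps_X"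
  define Q where "Q = X ^ D"
  define N where "N = 2 * n + 1"
  define C where "C = D * (n * n + n * 1 + n * (n - 1) div 2) + 0 * n"
  define t where "t = (\<lambda>k. qbin Q N k * Q ^ (k * (k - 1) div 2) * (- 1) ^ k * (Q ^ n) ^ (N - k))"
  have t: "t k = X ^ C * (- 1) ^ n
      * (fps_const (alt (int k - int n)) * qbin Q N k * X ^ theta_exp D 0 (int k - int n))"
    if "k \<le> N" for k
    using q_binomial_term[OF D _ that[unfolded N_def], of 0 X]
    by (simp add: t_def N_def Q_def C_def alt_diff fps_const_int alt_of_nat mult_ac flip: power_mult_distrib)
  have "(\<Sum>k\<le>N. t k) = (\<Prod>i<N. Q ^ n + - 1 * Q ^ i)"
    unfolding q_binomial t_def ..
  also have "\<dots> = 0" by (rule prod_zero) (auto simp: N_def intro!: bexI[of _ n])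
  finally have t0: "(\<Sum>k\<le>N. t k) = 0" .
  have "Q ^ n * (\<Prod>i\<in>{..<N} - {n}. Q ^ n + - 1 * Q ^ i) =
     (\<Sum>k\<le>N. of_nat k * (qbin Q N k * Q ^ (k * (k - 1) div 2) * (- 1) ^ (k - 1)
         * (Q ^ n) ^ (N - k)))"
    by (rule q_binomial_deriv) (auto simp: N_def)
  also have "\<dots> = (\<Sum>k\<le>N. - (of_nat k * t k))"
  proof (rule sum.cong)
    fix k
    \<comment> \<open>At \<open>k = 0\<close> the truncated exponent \<open>k - 1\<close> is
      harmless because the weight is 0.\<close>
    show "of_nat k * (qbin Q N k * Q ^ (k * (k - 1) div 2) * (- 1) ^ (k - 1)
        * (Q ^ n) ^ (N - k)) = - (of_nat k * t k)"
      by (cases k) (auto simp: t_def)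
  qed simp
  also have "\<dots> = - (\<Sum>k\<le>N. of_int (int k - int n) * t k)"
  proof -
    \<comment> \<open>Since the \<open>t k\<close> sum to 0, the weight \<open>k\<close> may be
      recentred to \<open>k - n\<close>.\<close>
    have "(\<Sum>k\<le>N. of_int (int k - int n) * t k) = (\<Sum>k\<le>N. of_nat k * t k) - of_nat n * (\<Sum>k\<le>N. t k)"
      by (simp add: left_diff_distrib sum_subtractf sum_distrib_left)
    then show ?thesis unfolding t0 by (simp add: sum_negf)
  qed
  also have "(\<Sum>k\<le>N. of_int (int k - int n) * t k)
      = X ^ C * (- 1) ^ n * (\<Sum>k\<le>N. fps_const (alt (int k - int n) * (int k - int n))
      * qbin Q N k * X ^ theta_exp D 0 (int k - int n))"
    unfolding sum_distrib_left
    by (intro sum.cong refl) (simp add: t fps_const_int mult_ac)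
  also have "(\<Sum>k\<le>N. fps_const (alt (int k - int n) * (int k - int n)) * qbin Q N k
      * X ^ theta_exp D 0 (int k - int n)) = ?S"
    unfolding N_def sum_atMost_int_shift Q_def X_def by (intro sum.cong) auto
  finally have 1: "Q ^ n * (\<Prod>i\<in>{..<N} - {n}. Q ^ n + - 1 * Q ^ i) = - (X ^ C * (- 1) ^ n * ?S)" .
  have split: "{..<N} - {n} = {..<n} \<union> {0 + Suc n..<n + Suc n}" by (auto simp: N_def)
  have "(\<Prod>i\<in>{..<N} - {n}. Q ^ n + - 1 * Q ^ i)
      = (\<Prod>i<n. Q ^ n + - 1 * Q ^ i) * (\<Prod>i\<in>{0 + Suc n..<n + Suc n}. Q ^ n + - 1 * Q ^ i)"
    unfolding split by (rule prod.union_disjoint) auto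
  also have "(\<Prod>i\<in>{0 + Suc n..<n + Suc n}. Q ^ n + - 1 * Q ^ i) = (\<Prod>i<n. Q ^ n * (1 - Q ^ Suc i))"
    unfolding prod.shift_bounds_nat_ivl lessThan_atLeast0
    by (intro prod.cong refl) (simp add: algebra_simps flip: power_add)
  also have "\<dots> = Q ^ (n * n) * qpoch Q n"
    by (simp add: prod.distrib qpoch_def power_mult)
  also have "(\<Prod>i<n. Q ^ n + - 1 * Q ^ i)
      = (\<Prod>i<n. - (X ^ (0 + D * i)) * (1 - Q ^ Suc (n - Suc i)))"
  proof (rule prod.cong)
    fix i assume "i \<in> {..<n}"
    then obtain m where n: "n = Suc i + m" by (metis lessThan_iff less_iff_Suc_add add_Suc)
    then show "Q ^ n + - 1 * Q ^ i = - (X ^ (0 + D * i)) * (1 - Q ^ Suc (n - Suc i))"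
      by (simp add: Q_def power_mult power_add algebra_simps)
  qed simp
  also have "\<dots> = (- 1) ^ n * X ^ (D * (n * (n - 1) div 2)) * qpoch Q n"
    unfolding prod.distrib prod_power_linear prod.nat_diff_reindex[of "\<lambda>i. 1
        - Q ^ Suc i" n] qpoch_def by simp
  finally have "Q ^ n * (\<Prod>i\<in>{..<N} - {n}. Q ^ n + - 1 * Q ^ i)
      = X ^ C * (- 1) ^ n * (qpoch Q n)\<^sup>2"
    by (simp add: C_def Q_def power2_eq_square power_add distrib_left mult_ac power_mult)
  with 1 have "X ^ C * (- 1) ^ n * (qpoch Q n)\<^sup>2 = - (X ^ C * (- 1) ^ n * ?S)" by (simp only:)
  then have "X ^ C * (- 1) ^ n * - (qpoch Q n)\<^sup>2 = X ^ C * (- 1) ^ n * ?S"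
    by (simp only: mult_minus_right minus_minus)
  moreover have "X ^ C * (- 1) ^ n \<noteq> 0" by (simp add: X_def)
  ultimately have "- (qpoch Q n)\<^sup>2 = ?S" by (rule mult_left_cancel[THEN iffD1, rotated])
  then show ?thesis by (simp only: Q_def X_def)
qed

section \<open>Theta series as infinite products: Euler, Gauss, Jacobi\<close>

lemma qpoch_pow:
  "qpoch (X ^ d) n = (\<Prod>i<n. 1 - X ^ (d * Suc i))"
  by (simp only: qpoch_def power_mult)

lemma qprod_cong':
  assumes "d > 0" "n \<le> m"
  shows "fps_X ^ n dvd qprod d - qpoch (fps_X ^ d) m"
  using qprod_cong[OF assms(1), of m] assms(2)
  by (meson dvd_trans le_imp_power_dvd le_Suc_eq le_trans)

text \<open>Euler's pentagonal number theorem: for \<open>D = 3 * d\<close> and \<open>a = d\<close>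
  the three families of factors are the multiples of \<open>d\<close> sorted by residue modulo
  \<open>3 * d\<close>.\<close>

lemma theta_pentagonal:
  assumes d: "d > 0"
  shows "gseries alt (theta_exp (3 * d) d) = qprod d"
proof (rule fps_eqI_dvd)
  fix n
  define P :: "int fps" where "P = (\<Prod>i<n. (1 - fps_X ^ (d + 3 * d * i))
      * (1 - fps_X ^ (3 * d - d + 3 * d * i)))"
  have P: "P * qpoch (fps_X ^ (3 * d)) n = qpoch (fps_X ^ d) (3 * n)"
  proof -
    have "qpoch (fps_X ^ d) (3 * n) =
       (\<Prod>i<n. (1 - fps_X ^ (d + 3 * d * i)) * (1 - fps_X ^ (3 * d - d + 3 * d * i))
           * (1 - fps_X ^ (3 * d * Suc i)) :: int fps)"
      unfolding qpoch_pow by (induction n) (simp_all add: algebra_simps numeral_3_eq_3 del: power_Suc)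
    then show ?thesis by (simp only: P_def qpoch_pow prod.distrib)
  qed
  have "fps_X ^ n dvd P * qprod (3 * d) - gseries alt (theta_exp (3 * d) d)"
    unfolding P_def using theta_limit[of "3 * d" d n alt 0] d by (subst jacobi_triple_finite) auto
  then have "fps_X ^ n dvd P * (qprod (3 * d) - qpoch (fps_X ^ (3 * d)) n)
      - (P * qprod (3 * d) - gseries alt (theta_exp (3 * d) d))
          - (qprod d - qpoch (fps_X ^ d) (3 * n))"
    using qprod_cong'[of "3 * d" n n] qprod_cong'[of d n "3 * n"] d
        by (simp only: dvd_diff dvd_mult)
  also have "\<dots> = gseries alt (theta_exp (3 * d) d) - qprod d"
    using P by (simp add: algebra_simps)
  finally show "fps_X ^ n dvd gseries alt (theta_exp (3 * d) d) - qprod d" .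
qed

text \<open>For \<open>D = 2 * d\<close> and \<open>a = d\<close> the two families of the triple
  product coincide, so odd multiples of \<open>d\<close> occur squared; supplying the even multiples
  twice completes the square of \<open>qprod d\<close>.\<close>

lemma theta_gauss:
  assumes d: "d > 0"
  shows "qprod (2 * d) * gseries alt (theta_exp (2 * d) d) = (qprod d)\<^sup>2"
proof (rule fps_eqI_dvd)
  fix n
  define P :: "int fps" where "P = (\<Prod>i<n. (1 - fps_X ^ (d + 2 * d * i))
      * (1 - fps_X ^ (2 * d - d + 2 * d * i)))"
  have P: "P * (qpoch (fps_X ^ (2 * d)) n * qpoch (fps_X ^ (2 * d)) n)
      = qpoch (fps_X ^ d) (2 * n) * qpoch (fps_X ^ d) (2 * n)"
  proof -
    have "qpoch (fps_X ^ d) (2 * n) =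
       (\<Prod>i<n. (1 - fps_X ^ (d + 2 * d * i)) * (1 - fps_X ^ (2 * d * Suc i)) :: int fps)"
      unfolding qpoch_pow by (induction n) (simp_all add: algebra_simps del: power_Suc)
    moreover have "2 * d - d = d" by simp
    ultimately show ?thesis by (simp only: P_def qpoch_pow prod.distrib mult_ac)
  qed
  let ?g = "gseries alt (theta_exp (2 * d) d)" and ?q = "qprod (2 * d)"
  have "fps_X ^ n dvd P * ?q - ?g"
    unfolding P_def using theta_limit[of "2 * d" d n alt 0] d by (subst jacobi_triple_finite) auto
  moreover have "fps_X ^ n dvd ?q * ?q - qpoch (fps_X ^ (2 * d)) n * qpoch (fps_X ^ (2 * d)) n"
    using d by (intro dvd_diff_mult qprod_cong') auto
  moreover have "fps_X ^ n dvd qprod d * qprod d - qpoch (fps_X ^ d) (2 * n)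
      * qpoch (fps_X ^ d) (2 * n)"
    using d by (intro dvd_diff_mult qprod_cong') auto
  ultimately have "fps_X ^ n dvd P
      * (?q * ?q - qpoch (fps_X ^ (2 * d)) n * qpoch (fps_X ^ (2 * d)) n)
      - ?q * (P * ?q - ?g) - (qprod d * qprod d - qpoch (fps_X ^ d) (2 * n)
          * qpoch (fps_X ^ d) (2 * n))"
    by (simp only: dvd_diff dvd_mult)
  also have "\<dots> = ?q * ?g - (qprod d)\<^sup>2"
    using P by (simp add: algebra_simps power2_eq_square)
  finally show "fps_X ^ n dvd ?q * ?g - (qprod d)\<^sup>2" .
qed

text \<open>Jacobi's identity: pairing \<open>j\<close> with \<open>1 - j\<close>, which have the
  same exponent, gives the familiar odd weights \<open>2 * j - 1\<close>.\<close>

lemma theta_jacobi_cube: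
  assumes d: "d > 0"
  shows "gseries (\<lambda>j. alt j * j) (theta_exp d 0) = - (qprod d ^ 3)"
proof (rule fps_eqI_dvd)
  fix n
  let ?g = "gseries (\<lambda>j. alt j * j) (theta_exp d 0)"
  let ?p = "qpoch (fps_X ^ d) n"
  have "fps_X ^ n dvd - ?p\<^sup>2 * qprod d - ?g"
    using theta_limit[of d 0 n "\<lambda>j. alt j * j" 1] d by (simp only: qpoch_square_finite)
  moreover have "fps_X ^ n dvd qprod d * (qprod d * qprod d - ?p * ?p)"
    using d by (intro dvd_mult dvd_diff_mult qprod_cong') auto
  ultimately have "fps_X ^ n dvd qprod d * (qprod d * qprod d - ?p * ?p)
      - (- ?p\<^sup>2 * qprod d - ?g)"
    by (simp only: dvd_diff)
  also have "\<dots> = ?g - (- (qprod d ^ 3))"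
    by (simp add: algebra_simps power2_eq_square power3_eq_cube)
  finally show "fps_X ^ n dvd ?g - (- (qprod d ^ 3))" .
qed

subsection \<open>Gordon's identity\<close>

lemma two_theta_exp:
  assumes "D > 0" "a \<le> D"
  shows "2 * int (theta_exp D a j) = int D * (j * (j - 1)) + 2 * int a * j"
  using int_theta_exp[OF assms, of j] two_triangle[of j]
      by (simp only: distrib_left mult.left_commute[of 2 "int D"] mult.assoc)

text \<open>
  Put \<open>u = 2 j - 1\<close>. By the symmetries \<open>j \<mapsto> 1 - j\<close> and \<open>n \<mapsto> - n\<close> the weight \<open>2 j\<close> may be replaced by
  \<open>a = u - 4 n\<close>, the rational part of \<open>(u + 2 n \<surd>-2) (1 + \<surd>-2) = a + b \<surd>-2\<close>. This multiplication by an element of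
  norm 3 turns \<open>u\<^sup>2 + 8 n\<^sup>2\<close> into \<open>(a\<^sup>2 + 2 b\<^sup>2) / 3\<close> with \<open>a\<close> and \<open>b\<close> congruent modulo 6. The classes \<open>\<plusminus>1\<close>
  contribute equally, and the class 3 cancels under \<open>b \<mapsto> - b\<close>.
\<close>

lemma theta_jacobi_gauss_reindex:
  fixes d M :: int
  defines "S \<equiv> {(j, n). d * (j * (j - 1) + 2 * n\<^sup>2) = M}"
    and "T \<equiv> {(l, k). d * (6 * l\<^sup>2 - 2 * l + 3 * k\<^sup>2 - k) = M}"
  assumes fin: "finite S"
  shows "(\<Sum>(j, n)\<in>S. alt j * j * alt n) = (\<Sum>(l, k)\<in>T. alt l * (6 * k - 1))"
proof -
  define F where "F = (\<lambda>(j, n). alt j * alt n * (2 * j - 1 - 4 * n))"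
  \<comment> \<open>As \<open>b = 2 * (j + n) - 1\<close>, sorting \<open>j + n\<close> modulo 3
    sorts \<open>b\<close> modulo 6: the values 0, 1, 2 of \<open>r\<close> belong to -1, 1,
    3.\<close>
  define S' where "S' = (\<lambda>r. {p \<in> S. (fst p + snd p) mod 3 = r})"
  have "(\<Sum>(j, n)\<in>S. alt j * j * alt n) = (\<Sum>(j, n)\<in>S. alt j * alt n * (j - 1))"
    by (rule sum.reindex_bij_witness[where i = "\<lambda>(j, n). (1 - j, n)" and j
        = "\<lambda>(j, n). (1 - j, n)"])
       (auto simp: S_def alt_def algebra_simps)
  moreover have "(\<Sum>(j, n)\<in>S. alt j * alt n * n) = (\<Sum>(j, n)\<in>S. - (alt j * alt n * n))"
    by (rule sum.reindex_bij_witness[where i = "\<lambda>(j, n). (j, - n)" and j = "\<lambda>(j, n). (j, - n)"])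
       (auto simp: S_def alt_def algebra_simps)
  moreover have "(\<Sum>p\<in>S. F p) = (\<Sum>(j, n)\<in>S. alt j * j * alt n)
      + (\<Sum>(j, n)\<in>S. alt j * alt n * (j - 1))
      - 4 * (\<Sum>(j, n)\<in>S. alt j * alt n * n)"
    unfolding F_def sum_distrib_left sum.distrib[symmetric] sum_subtractf[symmetric]
    by (intro sum.cong) (auto simp: algebra_simps)
  ultimately have 1: "2 * (\<Sum>(j, n)\<in>S. alt j * j * alt n) = (\<Sum>p\<in>S. F p)"
    by (simp add: case_prod_unfold sum_negf)
  have S: "S = S' 0 \<union> (S' 1 \<union> S' 2)" unfolding S'_def by auto
  have "finite (S' r)" for r unfolding S'_def using fin by simp
  then have 2: "(\<Sum>p\<in>S. F p) = (\<Sum>p\<in>S' 0. F p) + ((\<Sum>p\<in>S' 1. F p) + (\<Sum>p\<in>S' 2. F p))"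
    unfolding S by (simp add: sum.union_disjoint S'_def disjoint_iff)
  have 3: "(\<Sum>p\<in>S' 1. F p) = (\<Sum>p\<in>S' 0. F p)"
  proof -
    \<comment> \<open>This negates both \<open>a\<close> and \<open>b\<close>.\<close>
    let ?h = "\<lambda>(j :: int, n :: int). (1 - j, - n)"
    have *: "?h p \<in> S" if "p \<in> S" for p
      using that by (auto simp: S_def algebra_simps)
    have m1: "(1 - j + - n) mod 3 = 0" if "(j + n) mod 3 = 1" for j n :: int
      using that by presburger
    have m0: "(1 - j + - n) mod 3 = 1" if "(j + n) mod 3 = 0" for j n :: int
      using that by presburger
    show ?thesis
    proof (rule sum.reindex_bij_witness[where i = ?h and j = ?h])
      show "?h (?h p) = p" for p by (simp add: case_prod_unfold)
      then show "?h (?h p) = p" for p .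
      show "?h p \<in> S' 0" if "p \<in> S' 1" for p
        using *[of p] m1[of "fst p" "snd p"] that by (simp add: S'_def case_prod_unfold)
      show "?h p \<in> S' 1" if "p \<in> S' 0" for p
        using *[of p] m0[of "fst p" "snd p"] that by (simp add: S'_def case_prod_unfold)
      show "F (?h p) = F p" for p
        by (auto simp: F_def alt_def case_prod_unfold)
    qed
  qed
  have 4: "(\<Sum>p\<in>S' 2. F p) = (\<Sum>p\<in>S' 2. - F p)"
  proof -
    \<comment> \<open>The map that fixes \<open>a\<close> and negates \<open>b\<close>, solved for
      \<open>j\<close> and \<open>n\<close>; in this class the division by 3 is exact.\<close>
    let ?h = "\<lambda>(j :: int, n :: int). (- n - (j + n - 2) div 3, n - 1 - 2 * ((j + n - 2) div 3))"
    have *: "?h (?h p) = p \<and> ?h p \<in> S' 2 \<and> - F (?h p) = F p" if p: "p \<in> S' 2" for p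
    proof -
      obtain j n where p': "p = (j, n)" by force
      define t where "t = (j + n - 2) div 3"
      have "(j + n) mod 3 = 2" using p by (simp add: p' S'_def)
      then have j: "j = 2 - n + 3 * t" unfolding t_def by presburger
      have h: "?h p = (- n - t, n - 1 - 2 * t)" by (simp add: p' t_def)
      have t': "(- n - t + (n - 1 - 2 * t) - 2) div 3 = - 1 - t" by simp
      have "?h (?h p) = p" unfolding h using t' by (simp add: p' j)
      moreover have "?h p \<in> S' 2"
      proof -
        have "(- n - t) * (- n - t - 1) + 2 * (n - 1 - 2 * t)\<^sup>2 = j * (j - 1) + 2 * n\<^sup>2"
          unfolding j by (simp add: power2_eq_square algebra_simps)
        moreover have "(- n - t + (n - 1 - 2 * t)) mod 3 = 2" by presburger
        ultimately have "(- n - t, n - 1 - 2 * t) \<in> S' 2"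
          using p unfolding p' S'_def S_def by simp
        then show ?thesis unfolding h .
      qed
      moreover have "- F (?h p) = F p"
        unfolding h p' F_def by (simp add: j alt_def algebra_simps)
      ultimately show ?thesis by blast
    qed
    show ?thesis
      by (rule sum.reindex_bij_witness[where i = ?h and j = ?h]) (use * in \<open>blast+\<close>)
  qed
  have 5: "(\<Sum>p\<in>S' 0. F p) = (\<Sum>(l, k)\<in>T. alt l * (6 * k - 1))"
  proof -
    \<comment> \<open>The new variables are read off from \<open>b = 6 * l - 1\<close> and
      \<open>a = 6 * k - 1\<close>.\<close>
    let ?i = "\<lambda>(l :: int, k). (k + 2 * l, l - k)"
        and ?j = "\<lambda>(j, n). ((j + n) div 3, (j + n) div 3 - n)"
    have *: "?i (?j p) = p \<and> ?j p \<in> T \<and> (case ?j p of (l, k) \<Rightarrow> alt l * (6 * k - 1)) = F p"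
        if p: "p \<in> S' 0" for p
    proof -
      obtain j n where p': "p = (j, n)" by force
      define l where "l = (j + n) div 3"
      have j: "j = 3 * l - n" using p unfolding p' S'_def l_def by auto
      have h: "?j p = (l, l - n)" by (simp add: p' l_def)
      have 1: "?i (?j p) = p" unfolding h by (simp add: p' j)
      have "6 * l\<^sup>2 - 2 * l + 3 * (l - n)\<^sup>2 - (l - n) = j * (j - 1) + 2 * n\<^sup>2"
        unfolding j by (simp add: power2_eq_square algebra_simps)
      then have "(l, l - n) \<in> T" using p unfolding p' S'_def S_def T_def by simp
      then have 2: "?j p \<in> T" unfolding h .
      have "(case ?j p of (l, k) \<Rightarrow> alt l * (6 * k - 1)) = F p"
        unfolding h p' F_def by (simp add: j alt_def algebra_simps)
      with 1 2 show ?thesis by blast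
    qed
    have **: "?j (?i p) = p \<and> ?i p \<in> S' 0" if p: "p \<in> T" for p
    proof -
      obtain l k where p': "p = (l, k)" by force
      have e: "k + 2 * l + (l - k) = 3 * l" by simp
      have 1: "?j (?i p) = p" unfolding p' by (simp add: e)
      have "(k + 2 * l) * (k + 2 * l - 1) + 2 * (l - k)\<^sup>2 = 6 * l\<^sup>2 - 2 * l + 3 * k\<^sup>2 - k"
        by (simp add: power2_eq_square algebra_simps)
      then have "?i p \<in> S' 0" using p unfolding p' T_def S'_def S_def by (simp add: e)
      with 1 show ?thesis by blast
    qed
    show ?thesis
      by (rule sum.reindex_bij_witness[where i = ?i and j = ?j]) (use * ** in \<open>blast+\<close>)
  qed
  from 4 have "(\<Sum>p\<in>S' 2. F p) = 0" by (simp add: sum_negf)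
  with 1 2 3 5 show ?thesis by simp
qed

text \<open>Jacobi's series for the cube is multiplied by Gauss' theta series. The reindexing turns
  the product, up to sign, into Euler's series for \<open>qprod (2 * d)\<close> times the Gordon
  series.\<close>

lemma theta_gordon:
  assumes d: "d > 0"
  shows "qprod d ^ 5 = (qprod (2 * d))\<^sup>2 * gseries (\<lambda>k. 1 - 6 * k) (theta_exp (3 * d) d)"
proof -
  let ?J = "gseries (\<lambda>j. alt j * j) (theta_exp d 0)" and ?G = "gseries alt (theta_exp (2 * d) d)"
    and ?P = "gseries alt (theta_exp (6 * d) (2 * d))"
        and ?R = "gseries (\<lambda>k. 1 - 6 * k) (theta_exp (3 * d) d)"
  have "?J * ?G = - (?P * ?R)"
  proof (rule fps_ext)
    fix m
    let ?S = "{(j, n). theta_exp d 0 j + theta_exp (2 * d) d n = m}"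
    let ?T = "{(l, k). theta_exp (6 * d) (2 * d) l + theta_exp (3 * d) d k = m}"
    have S: "?S = {(j, n). int d * (j * (j - 1) + 2 * n\<^sup>2) = 2 * int m}"
    proof -
      have "theta_exp d 0 j + theta_exp (2 * d) d n = m \<longleftrightarrow> int d * (j * (j - 1) + 2 * n\<^sup>2)
          = 2 * int m" for j n
      proof -
        have eq: "2 * int (theta_exp d 0 j + theta_exp (2 * d) d n)
            = int d * (j * (j - 1) + 2 * n\<^sup>2)"
          using two_theta_exp[of d 0 j] two_theta_exp[of "2 * d" d n] d
          by (simp add: algebra_simps power2_eq_square)
        show ?thesis unfolding eq[symmetric] by (simp del: of_nat_add)
      qed
      then show ?thesis by simp
    qed
    have T: "?T = {(l, k). int d * (6 * l\<^sup>2 - 2 * l + 3 * k\<^sup>2 - k) = 2 * int m}"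
    proof -
      have "theta_exp (6 * d) (2 * d) l + theta_exp (3 * d) d k = m
          \<longleftrightarrow> int d * (6 * l\<^sup>2 - 2 * l + 3 * k\<^sup>2 - k) = 2 * int m" for l k
      proof -
        have eq: "2 * int (theta_exp (6 * d) (2 * d) l + theta_exp (3 * d) d k)
            = int d * (6 * l\<^sup>2 - 2 * l + 3 * k\<^sup>2 - k)"
          using two_theta_exp[of "6 * d" "2 * d" l] two_theta_exp[of "3 * d" d k] d
          by (simp add: algebra_simps power2_eq_square)
        show ?thesis unfolding eq[symmetric] by (simp del: of_nat_add)
      qed
      then show ?thesis by simp
    qed
    have "finite ?S"
    proof (rule finite_subset)
      show "?S \<subseteq> (\<Union>i\<in>{..m}. {j. theta_exp d 0 j = i})
          \<times> (\<Union>i\<in>{..m}. {n. theta_exp (2 * d) d n = i})"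
        by auto
      show "finite \<dots>"
        using d by (intro finite_cartesian_product finite_UN_I finite_theta_exp) auto
    qed
    then have "(\<Sum>(j, n)\<in>?S. alt j * j * alt n) = (\<Sum>(l, k)\<in>?T. alt l * (6 * k - 1))"
      unfolding S T by (rule theta_jacobi_gauss_reindex)
    also have "\<dots> = - (\<Sum>(l, k)\<in>?T. alt l * (1 - 6 * k))"
      unfolding sum_negf[symmetric] by (intro sum.cong) (auto simp: algebra_simps)
    finally have *: "(\<Sum>(j, n)\<in>?S. alt j * j * alt n) = - (\<Sum>(l, k)\<in>?T. alt l * (1 - 6 * k))" .
    have "?J * ?G = gseries (\<lambda>(j, n). alt j * j * alt n) (\<lambda>(j, n). theta_exp d 0 j
        + theta_exp (2 * d) d n)"
      using d by (intro gseries_mult finite_theta_exp) auto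
    moreover have "?P * ?R = gseries (\<lambda>(l, k). alt l
        * (1 - 6 * k)) (\<lambda>(l, k). theta_exp (6 * d) (2 * d) l + theta_exp (3 * d) d k)"
      using d by (intro gseries_mult finite_theta_exp) auto
    ultimately show "fps_nth (?J * ?G) m = fps_nth (- (?P * ?R)) m"
      using * by (simp add: gseries_nth case_prod_unfold)
  qed
  moreover have "?J = - (qprod d ^ 3)" using theta_jacobi_cube[OF d] .
  moreover have "?P = qprod (2 * d)" using theta_pentagonal[of "2 * d"] d by simp
  ultimately have "qprod d ^ 3 * ?G = qprod (2 * d) * ?R" by simp
  \<comment> \<open>One more factor \<open>qprod (2 * d)\<close> turns Gauss' series into
    \<open>(qprod d)\<^sup>2\<close>, completing the fifth power.\<close>
  then have "qprod d ^ 3 * (qprod (2 * d) * ?G) = (qprod (2 * d))\<^sup>2 * ?R"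
    by (simp add: power2_eq_square mult_ac)
  then show ?thesis unfolding theta_gauss[OF d] by (simp flip: power_add)
qed

text \<open>The exponents are \<open>d * j\<^sup>2\<close>, so \<open>j\<close> and
  \<open>- j\<close> contribute equally and only \<open>j = 0\<close> is unpaired.\<close>

lemma theta_gauss_even:
  assumes d: "d > 0"
  shows "\<exists>h. gseries alt (theta_exp (2 * d) d) = 1 + 2 * h"
proof -
  let ?g = "gseries alt (theta_exp (2 * d) d)"
  have e: "theta_exp (2 * d) d j = d * (nat \<bar>j\<bar>)\<^sup>2" for j
  proof -
    have "2 * int (theta_exp (2 * d) d j) = 2 * (int d * j\<^sup>2)"
      using two_theta_exp[of "2 * d" d j] d by (simp add: algebra_simps power2_eq_square)
    moreover have "int (d * (nat \<bar>j\<bar>)\<^sup>2) = int d * j\<^sup>2" by simp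
    ultimately have "int (theta_exp (2 * d) d j) = int (d * (nat \<bar>j\<bar>)\<^sup>2)" by linarith
    then show ?thesis by (simp only: of_nat_eq_iff)
  qed
  have "even (fps_nth ?g m - fps_nth 1 m)" for m
  proof (cases "m = 0")
    case True
    then have "{j. theta_exp (2 * d) d j = m} = {0}" using d by (auto simp: e)
    then show ?thesis using True by (simp add: gseries_nth alt_def)
  next
    case False
    let ?A = "{j. theta_exp (2 * d) d j = m \<and> j > 0}"
        and ?B = "{j. theta_exp (2 * d) d j = m \<and> j < 0}"
    have AB: "{j. theta_exp (2 * d) d j = m} = ?A \<union> ?B"
    proof -
      have "j \<noteq> 0" if "theta_exp (2 * d) d j = m" for j using that False by (auto simp: e)
      then show ?thesis by force
    qed
    have "finite {j. theta_exp (2 * d) d j = m}" using d by (intro finite_theta_exp) auto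
    then have "fps_nth ?g m = sum alt ?A + sum alt ?B"
      unfolding gseries_nth AB by (intro sum.union_disjoint) auto
    also have "sum alt ?B = sum alt ?A"
      by (rule sum.reindex_bij_witness[where i = uminus and j = uminus]) (auto simp: e alt_def)
    finally show ?thesis using False by simp
  qed
  then have "?g = 1 + 2 * Abs_fps (\<lambda>m. (fps_nth ?g m - fps_nth 1 m) div 2)"
    by (intro fps_ext) (simp add: numeral_fps_const)
  then show ?thesis by blast
qed

subsection \<open>The congruence\<close>

lemma EO_u_mod_16:
  "[EO_u m = 2 * fps_nth ((qprod 2)\<^sup>2) m
      - fps_nth (qprod 2 * gseries (\<lambda>k. 1 - 6 * k) (theta_exp 6 2)) m] (mod 16)"
proof -
  define A where "A = Abs_fps EO_u"
  define x where "x = (qprod 2)\<^sup>2"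
  define y where "y = qprod 4"
  define G where "G = qprod 2 * gseries (\<lambda>k. 1 - 6 * k) (theta_exp 6 2)"
  obtain h where "gseries alt (theta_exp (2 * 2) 2)
      = 1 + 2 * h" using theta_gauss_even[of 2] by auto
  then have x: "x = y * (1 + 2 * h)" using theta_gauss[of 2] by (simp add: x_def y_def)
  have A: "A * x = y\<^sup>2" using EO_u_generating_function by (simp add: A_def x_def y_def)
  have G: "y\<^sup>2 * G = x ^ 3"
  proof -
    have "y\<^sup>2 * G = qprod 2 * qprod 2 ^ 5"
      using theta_gordon[of 2] by (simp add: y_def G_def mult_ac)
    also have "\<dots> = x ^ 3" by (simp add: x_def flip: power_Suc power_mult)
    finally show ?thesis .
  qed
  have "(x * y\<^sup>2) * (A - 2 * x + G) = (A * x) * y\<^sup>2 - 2 * x\<^sup>2 * y\<^sup>2 + x * (y\<^sup>2 * G)"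
    by (simp add: algebra_simps power2_eq_square)
  also have "\<dots> = (x\<^sup>2 - y\<^sup>2)\<^sup>2"
    unfolding A G by (simp add: algebra_simps power2_eq_square power3_eq_cube)
  \<comment> \<open>From \<open>x = y * (1 + 2 * h)\<close> follows
    \<open>x\<^sup>2 - y\<^sup>2 = 4 * y\<^sup>2 * h * (1 + h)\<close>.\<close>
  also have "\<dots> = 16 * (y\<^sup>2 * h * (1 + h))\<^sup>2"
    unfolding x by (simp add: algebra_simps power2_eq_square)
  finally have "16 dvd (x * y\<^sup>2) * (A - 2 * x + G)" by simp
  moreover have "fps_nth (x * y\<^sup>2) 0 = 1"
    by (simp add: x_def y_def power2_eq_square fps_mult_nth_0 qprod_nth_0)
  ultimately have "16 dvd A - 2 * x + G" by (rule fps_unit_dvd_cancel[rotated])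
  then obtain w where "A - 2 * x + G = 16 * w" by (rule dvdE)
  then have "fps_nth (A - 2 * x + G) m = 16 * fps_nth w m"
    by (simp add: numeral_fps_const)
  then have "EO_u m - (2 * fps_nth x m - fps_nth G m) = 16 * fps_nth w m"
    by (simp add: A_def numeral_fps_const)
  then show ?thesis unfolding cong_iff_dvd_diff x_def G_def by simp
qed

section \<open>Sums of two squares and the prime 7\<close>

lemma square_mod_seven:
  fixes x :: int
  shows "7 dvd x \<or> x\<^sup>2 mod 7 = 1 \<or> x\<^sup>2 mod 7 = 2 \<or> x\<^sup>2 mod 7 = 4"
proof -
  have sq: "x\<^sup>2 mod 7 = (x mod 7)\<^sup>2 mod 7" by (simp only: power_mod)
  have "0 \<le> x mod 7" "x mod 7 < 7" by simp_all
  then consider "x mod 7 = 0" | "x mod 7 = 1" | "x mod 7 = 2" | "x mod 7 = 3" | "x mod 7 = 4"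
    | "x mod 7 = 5" | "x mod 7 = 6" by linarith
  then show ?thesis
  proof cases
    case 1
    then show ?thesis by (intro disjI1) (simp only: dvd_eq_mod_eq_0)
  qed (simp_all add: sq)
qed

text \<open>No two of the nonzero squares 1, 2, 4 modulo 7 add up to 0.\<close>

lemma seven_dvd_sum_squares:
  fixes u v :: int
  assumes "7 dvd u\<^sup>2 + v\<^sup>2"
  shows "7 dvd u \<and> 7 dvd v"
proof -
  have zero: "x\<^sup>2 mod 7 = 0" if "7 dvd x" for x :: int
    using that by (metis dvd_imp_mod_0 dvd_mult power2_eq_square)
  have sum: "(u\<^sup>2 mod 7 + v\<^sup>2 mod 7) mod 7 = 0"
    using assms by (simp only: mod_add_eq dvd_eq_mod_eq_0)
  show ?thesis
    using square_mod_seven[of u] square_mod_seven[of v] zero[of u] zero[of v] sum by fastforce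
qed

text \<open>Descent: 7 must divide \<open>u\<close> and \<open>v\<close>, and dividing both by 7
  lowers the exponent by 2. At exponent 1 this would make 7 divide \<open>q\<close>.\<close>

lemma sum_squares_neq_odd_power_seven:
  fixes u v q :: int
  assumes "\<not> 7 dvd q"
  shows "u\<^sup>2 + v\<^sup>2 \<noteq> 7 ^ (2 * k + 1) * q"
proof (induction k arbitrary: u v)
  case 0
  show ?case
  proof
    assume "u\<^sup>2 + v\<^sup>2 = 7 ^ (2 * 0 + 1) * q"
    then have eq: "u\<^sup>2 + v\<^sup>2 = 7 * q" by simp
    then have "7 dvd u" "7 dvd v" using seven_dvd_sum_squares[of u v] by simp_all
    then obtain a b where "u = 7 * a" "v = 7 * b" by (elim dvdE)
    with eq have "7 * (7 * (a\<^sup>2 + b\<^sup>2)) = 7 * q" by (simp add: power2_eq_square algebra_simps)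
    then have "q = 7 * (a\<^sup>2 + b\<^sup>2)" by linarith
    with assms show False by (metis dvd_triv_left)
  qed
next
  case (Suc k)
  show ?case
  proof
    define c where "c = 7 ^ (2 * k + 1) * q"
    assume "u\<^sup>2 + v\<^sup>2 = 7 ^ (2 * Suc k + 1) * q"
    then have eq: "u\<^sup>2 + v\<^sup>2 = 7 * (7 * c)" by (simp add: c_def)
    then have "7 dvd u" "7 dvd v" using seven_dvd_sum_squares[of u v] by simp_all
    then obtain a b where "u = 7 * a" "v = 7 * b" by (elim dvdE)
    with eq have "7 * (7 * (a\<^sup>2 + b\<^sup>2)) = 7 * (7 * c)"
        by (simp add: power2_eq_square algebra_simps)
    then have "a\<^sup>2 + b\<^sup>2 = c" by simp
    with Suc.IH[of a b] show False by (simp only: c_def)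
  qed
qed

text \<open>By completing the square, \<open>6 * i - 1\<close> and \<open>6 * j - 1\<close> would
  represent \<open>12 * m + 2\<close> as a sum of two squares, yet this number is
  \<open>7 ^ (2 * k + 1)\<close> times a factor prime to 7.\<close>

lemma theta_exponents_avoid_progression:
  fixes n k r :: nat
  defines "m \<equiv> 2 * 7 ^ (2 * k + 2) * n + 2 * 7 ^ (2 * k + 1) * r + (7 ^ (2 * k + 2) - 1) div 6"
  assumes r: "r \<in> {1, 2, 3, 4, 5, 6}"
  shows "theta_exp 6 2 i + theta_exp 6 2 j \<noteq> m"
proof
  assume eq: "theta_exp 6 2 i + theta_exp 6 2 j = m"
  have sq: "(6 * i - 1)\<^sup>2 = 12 * int (theta_exp 6 2 i) + 1" for i
    using two_theta_exp[of 6 2 i] by (simp add: power2_eq_square algebra_simps)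
  \<comment> \<open>This makes the division by 6 in \<open>m\<close> exact.\<close>
  have "[7 ^ (2 * k + 2) = 1 ^ (2 * k + 2)] (mod (6::nat))"
    by (intro cong_pow) (simp add: cong_def)
  then have "6 dvd (7 ^ (2 * k + 2) - 1 :: nat)"
    unfolding cong_def power_one by (subst (asm) mod_eq_dvd_iff_nat) (rule one_le_power, simp)
  then have "6 * ((7 ^ (2 * k + 2) - 1) div 6) = (7 ^ (2 * k + 2) - 1 :: nat)"
    by (rule dvd_mult_div_cancel)
  then have "12 * m + 2 = 24 * 7 ^ (2 * k + 2) * n + 24 * 7 ^ (2 * k + 1) * r
      + (2 * (7 ^ (2 * k + 2) - 1) + 2)"
    unfolding m_def by (simp add: algebra_simps)
  also have "2 * (7 ^ (2 * k + 2) - 1) + 2 = (2 * 7 ^ (2 * k + 2) :: nat)"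
    using one_le_power[of "7 :: nat" "2 * k + 2"] by linarith
  finally have "12 * m + 2 = 7 ^ (2 * k + 1) * (168 * n + 24 * r + 14)"
    by (simp add: algebra_simps)
  then have "12 * int m + 2 = 7 ^ (2 * k + 1) * int (168 * n + 24 * r + 14)"
    by (metis of_nat_add of_nat_mult of_nat_numeral of_nat_power)
  moreover have "(6 * i - 1)\<^sup>2 + (6 * j - 1)\<^sup>2 = 12 * int m + 2"
    unfolding sq eq[symmetric] by simp
  moreover have "\<not> 7 dvd int (168 * n + 24 * r + 14)"
    using r by (auto; presburger)
  ultimately show False using sum_squares_neq_odd_power_seven by metis
qed

theorem corollary5p1:
  fixes n k r :: nat
  assumes "r \<in> {1, 2, 3, 4, 5, 6}"
  shows "[EO_u (2 * 7 ^ (2 * k + 2) * n + 2 * 7 ^ (2 * k + 1) * r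
            + (7 ^ (2 * k + 2) - 1) div 6) = 0] (mod 16)"
proof -
  let ?m = "2 * 7 ^ (2 * k + 2) * n + 2 * 7 ^ (2 * k + 1) * r + (7 ^ (2 * k + 2) - 1) div 6"
  \<comment> \<open>Covers both products in \<open>EO_u_mod_16\<close>: by Euler's theorem
    \<open>qprod 2\<close> also has the exponents \<open>theta_exp 6 2\<close>, and only the
    coefficients differ.\<close>
  have vanish: "fps_nth (gseries c (theta_exp 6 2) * gseries c' (theta_exp 6 2)) ?m = 0" for c c'
  proof -
    have "gseries c (theta_exp 6 2) * gseries c' (theta_exp 6 2) =
        gseries (\<lambda>(i, j). c i * c' j) (\<lambda>(i, j). theta_exp 6 2 i + theta_exp 6 2 j)"
      by (intro gseries_mult finite_theta_exp) auto
    moreover have "{p. (\<lambda>(i, j). theta_exp 6 2 i + theta_exp 6 2 j) p = ?m} = {}"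
      using theta_exponents_avoid_progression[OF assms] by auto
    ultimately show ?thesis by (simp only: gseries_nth sum.empty)
  qed
  have "qprod 2 = gseries alt (theta_exp 6 2)" using theta_pentagonal[of 2] by simp
  then show ?thesis
    using EO_u_mod_16[of ?m] vanish by (simp only: power2_eq_square) simp
qed

end
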